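(* Let $\mathcal{H}$ be a real Hilbert space, let $S:\mathcal{H}\to 2^{\mathcal{H}}$ be maximal monotone, let $T:\mathcal{H}\to\mathcal{H}$ be monotone and Lipschitz continuous with constant $\mathsf{L}>0$, and assume that $(S+T)^{-1}(0)$ is nonempty. Let $\delta_0,\delta_1>0$, $\bar{\vartheta}\in[0,1)$, $\bar{\beta}\in(0,\frac14)$, $\bar{r}\in\left(\bar{\beta},\frac{1-2\bar{\beta}}{2}\right)$, let $\{\sigma_n\}_{n\ge1}$ be a sequence in $(0,1)$ and $\{c_n\}_{n\ge1}$ a sequence in $[0,\infty)$ with $\sum_{n=1}^\infty c_n<\infty$. For arbitrary $\hat{v},w_0,w_1\in\mathcal{H}$, let $\{w_n\}$ be generated by $$w_{n+1}=J^{S}_{\delta_n}\big(\sigma_n\hat{v}+(1-\sigma_n)(w_n+\bar{\vartheta}(w_n-w_{n-1}))-\delta_nTw_n-\delta_{n-1}(1-\sigma_n)(Tw_n-Tw_{n-1})\big),\quad n\ge1,$$ where, for $n\ge 1$, $$\delta_{n+1}=\begin{cases}\min\left\{\dfrac{\bar{r}\|w_n-w_{n+1}\|}{\|Tw_n-Tw_{n+1}\|},\ \delta_n+c_n\right\},&\text{if }Tw_n\ne Tw_{n+1},\\ \delta_n+c_n,&\text{otherwise.}\end{cases}$$ If $0\le\bar{\vartheta}<\min\left\{\frac{\bar{\beta}}{2},\frac{\frac12-\bar{r}}{2}\right\}$, $\lim_{n\to\infty}\sigma_n=0$ and $\sum_{n=1}^\infty\sigma_n=\infty$, then $\{w_n\}$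 converges strongly (i.e., in norm) to $P_{(S+T)^{-1}(0)}\hat{v}$.
   Context: $(S+T)^{-1}(0)=\{w\in\mathcal{H}: 0\in Sw+Tw\}$. For $\delta>0$, $J^S_\delta=(I_{\mathcal{H}}+\delta S)^{-1}$ is the resolvent of $S$, which is single-valued and everywhere defined when $S$ is maximal monotone. A set-valued operator $S$ is monotone if $\langle \hat a-\hat b,a-b\rangle\ge0$ for all $a,b\in\mathcal{H}$, $\hat a\in Sa$, $\hat b\in Sb$, and maximal monotone if, in addition, its graph is not properly contained in the graph of any other monotone operator. $T$ is monotone if $\langle Ta-Tb,a-b\rangle\ge0$ for all $a,b$, and Lipschitz continuous with constant $\mathsf{L}$ if $\|Ta-Tb\|\le\mathsf{L}\|a-b\|$ for all $a,b$. $P_C$ denotes the metric projection onto a nonempty closed convex set $C\subseteq\mathcal{H}$ (the set $(S+T)^{-1}(0)$ is closed and convex because $S+T$ is maximal monotone). *)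

theory Defs
  imports "HOL-Analysis.Analysis"
begin

definition op_graph :: "('a \<Rightarrow> 'a set) \<Rightarrow> ('a \<times> 'a) set" where
  "op_graph A = {(a, u). u \<in> A a}"

definition op_inverse :: "('a \<Rightarrow> 'a set) \<Rightarrow> 'a \<Rightarrow> 'a set" where
  "op_inverse A y = {x. y \<in> A x}"

definition monotone_op :: "('a::real_inner \<Rightarrow> 'a set) \<Rightarrow> bool" where
  "monotone_op A \<longleftrightarrow> (\<forall>a b. \<forall>u\<in>A a. \<forall>v\<in>A b. inner (u - v) (a - b) \<ge> 0)"

definition maximal_monotone_op :: "('a::real_inner \<Rightarrow> 'a set) \<Rightarrow> bool" where
  "maximal_monotone_op A \<longleftrightarrow>
     monotone_op A \<and> \<not> (\<exists>B. monotone_op B \<and> op_graph A \<subset> op_graph B)"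

text \<open>
  The set-valued inverse of I + d A at z is a singleton for every z when d > 0 and A is maximal
  monotone on a Hilbert space (Minty's theorem); otherwise the value may be unspecified.
\<close>
definition resolvent :: "real \<Rightarrow> ('a::real_inner \<Rightarrow> 'a set) \<Rightarrow> 'a \<Rightarrow> 'a" where
  "resolvent d A z = the_elem (op_inverse (\<lambda>x. (\<lambda>u. x + d *\<^sub>R u) ` A x) z)"

definition zeros_sum :: "('a::real_inner \<Rightarrow> 'a set) \<Rightarrow> ('a \<Rightarrow> 'a) \<Rightarrow> 'a set" where
  "zeros_sum S T = op_inverse (\<lambda>w. (\<lambda>u. u + T w) ` S w) 0"

text \<open>
  The library constant \<^const>\<open>closest_point\<close> is restricted to Heine-Borel spaces, i.e. to finite
  dimension. The value below is determined when C is nonempty, closed and convex in a Hilbert space.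
\<close>
definition metric_proj :: "'a::real_inner set \<Rightarrow> 'a \<Rightarrow> 'a" where
  "metric_proj C v = (THE p. p \<in> C \<and> (\<forall>y\<in>C. dist v p \<le> dist v y))"

end

theory Submission imports Defs
begin

text \<open>
  Let \<open>p\<close> be the projection of \<open>v\<close> onto the set of zeros, put \<open>d\<^sub>n = w\<^sub>n - w\<^sub>n\<^sub>-\<^sub>1\<close> and
  \<open>g\<^sub>n = \<delta>\<^sub>n\<^sub>-\<^sub>1 (T w\<^sub>n - T w\<^sub>n\<^sub>-\<^sub>1)\<close>. The adaptive steps converge to a positive limit, so that
  \<open>\<parallel>g\<^sub>n\<parallel> \<le> r' \<parallel>d\<^sub>n\<parallel>\<close> eventually, for a fixed \<open>r'\<close> slightly larger than \<open>r\<close>. The energy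
  \<open>E\<^sub>n = \<parallel>w\<^sub>n - p\<parallel>\<^sup>2 - 2 g\<^sub>n \<bullet> (w\<^sub>n - p) - \<theta> \<parallel>w\<^sub>n\<^sub>-\<^sub>1 - p\<parallel>\<^sup>2 + \<kappa> \<parallel>d\<^sub>n\<parallel>\<^sup>2\<close>
  dominates \<open>\<parallel>w\<^sub>n - p\<parallel>\<^sup>2 / 2\<close> and satisfies
  \<open>E\<^sub>n\<^sub>+\<^sub>1 \<le> (1 - \<sigma>\<^sub>n) E\<^sub>n + \<sigma>\<^sub>n b\<^sub>n - \<eta>/2 (\<parallel>d\<^sub>n\<parallel>\<^sup>2 + \<parallel>d\<^sub>n\<^sub>+\<^sub>1\<parallel>\<^sup>2)\<close> with
  \<open>b\<^sub>n = 2 (v - p) \<bullet> (w\<^sub>n\<^sub>+\<^sub>1 - p)\<close>. When both increments are small, \<open>w\<^sub>n\<^sub>+\<^sub>1\<close> is an approximate zero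
  of \<open>S + T\<close> and weak compactness gives \<open>b\<^sub>n \<le> \<epsilon>\<close>; otherwise the negative term absorbs \<open>\<sigma>\<^sub>n b\<^sub>n\<close>,
  because \<open>\<sigma>\<^sub>n\<close> tends to 0. Either way \<open>E\<^sub>n\<^sub>+\<^sub>1 \<le> (1 - \<sigma>\<^sub>n) E\<^sub>n + \<sigma>\<^sub>n \<epsilon>\<close> eventually, and the divergence of
  the series of the \<open>\<sigma>\<^sub>n\<close> forces \<open>E\<^sub>n\<close> to tend to 0.
\<close>

section \<open>Convexity in Hilbert spaces\<close>

text \<open>Common form of the two completeness arguments below: approximate optimisers of a
  uniformly convex problem have squared distance at most the sum of their optimality gaps.\<close>

lemma quadratic_Cauchy_limit:
  fixes x :: "nat \<Rightarrow> 'a::{real_inner, complete_space}"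
  assumes le: "\<And>m n. (norm (x m - x n))\<^sup>2 \<le> e m + e n" and e: "e \<longlonglongrightarrow> (0::real)"
  obtains l where "x \<longlonglongrightarrow> l"
proof -
  have "Cauchy x"
  proof (rule metric_CauchyI)
    fix d :: real assume d: "0 < d"
    hence "eventually (\<lambda>n. e n < d\<^sup>2 / 2) sequentially"
      by (intro order_tendstoD[OF e]) auto
    then obtain N where N: "\<And>n. n \<ge> N \<Longrightarrow> e n < d\<^sup>2 / 2"
      by (auto simp: eventually_sequentially)
    have "dist (x m) (x n) < d" if "m \<ge> N" "n \<ge> N" for m n
      using le[of m n] N[OF that(1)] N[OF that(2)] d
      by (intro power2_less_imp_less[of _ d]) (auto simp: dist_norm)
    thus "\<exists>M. \<forall>m\<ge>M. \<forall>n\<ge>M. dist (x m) (x n) < d" by blast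
  qed
  thus thesis using that Cauchy_convergent unfolding convergent_def by blast
qed

text \<open>Parallelogram law for \<open>x - v\<close> and \<open>y - v\<close>, with their sum
  written through the midpoint.\<close>

lemma norm_diff_sq_midpoint:
  fixes x y v :: "'a::real_inner"
  shows "(norm (x - y))\<^sup>2 = 2 * (norm (x - v))\<^sup>2 + 2 * (norm (y - v))\<^sup>2
           - 4 * (norm (((1/2) *\<^sub>R x + (1/2) *\<^sub>R y) - v))\<^sup>2"
  unfolding power2_norm_eq_inner
  by (simp add: algebra_simps inner_commute)

text \<open>Nearly closest points \<open>x n\<close> of \<open>K n\<close> to \<open>v\<close> form
  a Cauchy sequence: for \<open>m \<le> n\<close> the midpoint of \<open>x m\<close> and
  \<open>x n\<close> stays in \<open>K m\<close>, and the distances from \<open>v\<close> to the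
  sets increase to a limit. Constant sets give projections, convex hulls of tails give weak
  compactness.\<close>

lemma nested_convex_closure_point:
  fixes K :: "nat \<Rightarrow> 'a::{real_inner, complete_space} set"
  assumes conv: "\<And>n. convex (K n)" and ne: "\<And>n. K n \<noteq> {}" and dec: "decseq K"
    and B: "\<And>n. infdist v (K n) \<le> B"
  obtains x where "\<And>n. x \<in> closure (K n)" "dist v x \<le> B"
proof -
  define i where "i n = infdist v (K n)" for n
  have i_nonneg: "0 \<le> i n" for n by (simp add: i_def infdist_nonneg)
  have "incseq i"
    unfolding i_def using dec ne by (intro monoI infdist_mono) (auto simp: decseq_def)
  moreover have "\<And>n. i n \<le> B" using B by (simp add: i_def)
  ultimately obtain R where R: "i \<longlonglongrightarrow> R" and iR: "\<And>n. i n \<le> R"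
    using incseq_convergent[of i B] by blast
  have RB: "R \<le> B" using LIMSEQ_le_const2[OF R] B by (auto simp: i_def)
  have "\<exists>x\<in>K n. dist v x < i n + inverse (real (Suc n))" for n
  proof -
    have "(INF a\<in>K n. dist v a) < i n + inverse (real (Suc n))"
      unfolding i_def infdist_notempty[OF ne] by (simp only: less_add_same_cancel1) simp
    thus ?thesis using ne[of n] by (subst (asm) cINF_less_iff) (auto intro!: bdd_belowI2[where m=0])
  qed
  then obtain x where x: "\<And>n. x n \<in> K n"
    and xd: "\<And>n. dist v (x n) < i n + inverse (real (Suc n))" by metis
  define q where "q n = dist v (x n)" for n
  have q_lower: "i n \<le> q n" for n unfolding i_def q_def by (rule infdist_le[OF x])
  have up: "(\<lambda>n. i n + inverse (real (Suc n))) \<longlonglongrightarrow> R"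
    using tendsto_add[OF R LIMSEQ_inverse_real_of_nat] by simp
  have q: "q \<longlonglongrightarrow> R"
    by (rule tendsto_sandwich[OF _ _ R up]) (use q_lower xd in \<open>auto simp: q_def less_imp_le\<close>)
  \<comment> \<open>For \<open>m \<le> n\<close> the midpoint bound contains only
    \<open>i m\<close>. Since \<open>i n \<le> R\<close>, adding
    \<open>4 * (R\<^sup>2 - (i n)\<^sup>2)\<close> is harmless and makes the bound symmetric in
    \<open>m\<close> and \<open>n\<close>.\<close>
  define e where "e n = 2 * (q n)\<^sup>2 - 2 * R\<^sup>2 + 4 * (R\<^sup>2 - (i n)\<^sup>2)" for n
  have sq: "(i n)\<^sup>2 \<le> R\<^sup>2" for n using iR i_nonneg by (intro power_mono)
  have "e \<longlonglongrightarrow> 2 * R\<^sup>2 - 2 * R\<^sup>2 + 4 * (R\<^sup>2 - R\<^sup>2)"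
    unfolding e_def by (intro tendsto_intros q R)
  hence e: "e \<longlonglongrightarrow> 0" by simp
  have main: "(norm (x m - x n))\<^sup>2 \<le> e m + e n" if "m \<le> n" for m n
  proof -
    have "x n \<in> K m" using x dec that by (auto simp: decseq_def)
    hence "(1/2) *\<^sub>R x m + (1/2) *\<^sub>R x n \<in> K m"
      using convexD[OF conv[of m] x[of m]] by simp
    from infdist_le[OF this, of v]
    have "i m \<le> norm ((1/2) *\<^sub>R x m + (1/2) *\<^sub>R x n - v)"
      by (simp add: i_def dist_norm norm_minus_commute)
    hence "(i m)\<^sup>2 \<le> (norm ((1/2) *\<^sub>R x m + (1/2) *\<^sub>R x n - v))\<^sup>2"
      using i_nonneg by (intro power_mono)
    thus ?thesis
      using norm_diff_sq_midpoint[of "x m" "x n" v] sq[of n]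
      by (simp add: e_def q_def dist_norm norm_minus_commute)
  qed
  have "(norm (x m - x n))\<^sup>2 \<le> e m + e n" for m n
    using main[of m n] main[of n m] by (cases "m \<le> n") (auto simp: norm_minus_commute)
  then obtain l where l: "x \<longlonglongrightarrow> l" using quadratic_Cauchy_limit e by blast
  show thesis
  proof (rule that)
    fix n
    have "(\<lambda>k. x (k + n)) \<longlonglongrightarrow> l" using l by (rule LIMSEQ_ignore_initial_segment)
    moreover have "x (k + n) \<in> K n" for k
      using x[of "k + n"] decseqD[OF dec, of n "k + n"] by auto
    ultimately show "l \<in> closure (K n)" unfolding closure_sequential
      by (intro exI[of _ "\<lambda>k. x (k + n)"]) blast
  next
    have "q \<longlonglongrightarrow> dist v l" unfolding q_def by (intro tendsto_intros l)
    thus "dist v l \<le> B" using RB LIMSEQ_unique[OF q] by simp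
  qed
qed

text \<open>A nearest point comes from the nested-set lemma with constant sets; convexity makes it
  unique, so the \<open>THE\<close> in \<open>metric_proj\<close> is determined.\<close>

lemma metric_proj_exists:
  fixes C :: "'a::{real_inner, complete_space} set"
  assumes C: "convex C" "closed C" "C \<noteq> {}"
  shows "metric_proj C v \<in> C" "\<And>y. y \<in> C \<Longrightarrow> inner (v - metric_proj C v) (y - metric_proj C v) \<le> 0"
proof -
  obtain p where p: "p \<in> closure C" "dist v p \<le> infdist v C"
    by (rule nested_convex_closure_point[of "\<lambda>_. C" v "infdist v C"])
       (use C in \<open>auto simp: decseq_def\<close>)
  hence "p \<in> C \<and> (\<forall>y\<in>C. dist v p \<le> dist v y)"
    using C infdist_le[of _ C v] by force
  hence *: "metric_proj C v \<in> C \<and> (\<forall>y\<in>C. dist v (metric_proj C v) \<le> dist v y)"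
    unfolding metric_proj_def
    by (rule theI) (use any_closest_point_unique[OF C(1,2)] \<open>p \<in> C \<and> _\<close> in blast)
  thus "metric_proj C v \<in> C" by blast
  show "inner (v - metric_proj C v) (y - metric_proj C v) \<le> 0" if "y \<in> C" for y
    using any_closest_point_dot[OF C(1,2)] * that by blast
qed

text \<open>Stands in for weak sequential compactness: the point need not be a weak limit of a
  subsequence, but it satisfies every closed affine inequality that the sequence eventually
  satisfies.\<close>

lemma bounded_seq_weak_point:
  fixes y :: "nat \<Rightarrow> 'a::{real_inner, complete_space}"
  assumes bd: "\<And>n. norm (y n) \<le> B"
  obtains x where "\<And>h c. (\<forall>\<^sub>F k in sequentially. inner h (y k) \<le> c) \<Longrightarrow> inner h x \<le> c"
proof -
  \<comment> \<open>A closed half-space containing a tail of the sequence also contains the closed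
    convex hull of that tail, so a point common to all these closures inherits the
    inequality.\<close>
  define K where "K n = convex hull (y ` {n..})" for n
  have yK: "y n \<in> K n" for n unfolding K_def by (rule hull_inc) auto
  have "infdist 0 (K n) \<le> B" for n
    by (rule infdist_le2[OF yK]) (simp add: dist_norm bd)
  moreover have "decseq K" unfolding K_def decseq_def by (auto intro!: hull_mono)
  ultimately obtain x where x: "\<And>n. x \<in> closure (K n)"
    using nested_convex_closure_point[of K 0 B] yK
    by (metis K_def convex_convex_hull empty_iff)
  show thesis
  proof (rule that)
    fix h c assume "\<forall>\<^sub>F k in sequentially. inner h (y k) \<le> c"
    then obtain N where "\<And>k. k \<ge> N \<Longrightarrow> inner h (y k) \<le> c"
      by (auto simp: eventually_sequentially)
    hence "K N \<subseteq> {z. inner h z \<le> c}"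
      unfolding K_def by (intro hull_minimal convex_halfspace_le) auto
    hence "closure (K N) \<subseteq> {z. inner h z \<le> c}"
      by (intro closure_minimal closed_halfspace_le)
    thus "inner h x \<le> c" using x by blast
  qed
qed

section \<open>Maximal monotone operators\<close>

text \<open>Minty's theorem: the witness is the limit of a maximising sequence of the concave function
  \<open>g\<close> below on the convex hull of the lifted graph, which is the dual of minimising
  \<open>sup (x + u - z) \<bullet> (x - a)\<close> over \<open>x\<close>.\<close>

lemma monotone_set_extension:
  fixes G :: "('a::{real_inner, complete_space} \<times> 'a) set"
  assumes mono: "\<And>a u b t. (a, u) \<in> G \<Longrightarrow> (b, t) \<in> G \<Longrightarrow> inner (u - t) (a - b) \<ge> 0"
    and ne: "G \<noteq> {}"
  obtains x where "\<And>a u. (a, u) \<in> G \<Longrightarrow> inner (u - (z - x)) (a - x) \<ge> 0"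
proof -
  define C where "C = convex hull ((\<lambda>(a, u). (a, u, inner a u)) ` G)"
  \<comment> \<open>For \<open>P = (a, u, s)\<close> the dual objective at \<open>x\<close> is |x|^2
    - 2 x . m(P) + z . a - s; its minimiser in \<open>x\<close> is \<open>m P\<close> and its
    minimum is \<open>g P\<close>.\<close>
  define m where "m = (\<lambda>(a::'a, u::'a, s::real). (1/2) *\<^sub>R (a - u + z))"
  define g where "g P = inner z (fst P) - snd (snd P) - (norm (m P))\<^sup>2" for P
  have GC: "(a, u, inner a u) \<in> C" if "(a, u) \<in> G" for a u
    unfolding C_def by (rule hull_inc) (use that in force)
  have convC: "convex C" by (simp add: C_def)
  \<comment> \<open>On lifted graph points this is monotonicity. It is affine in \<open>P\<close>
    and in \<open>Q\<close> separately, so it passes to the hull one argument at a time.\<close>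
  have pair: "inner (fst P) (fst (snd Q)) + inner (fst Q) (fst (snd P)) \<le> snd (snd P) + snd (snd Q)"
    if "P \<in> C" "Q \<in> C" for P Q
  proof -
    have cvx: "convex {P :: 'a \<times> 'a \<times> real.
        inner (fst P) (fst (snd Q)) + inner (fst Q) (fst (snd P)) \<le> snd (snd P) + snd (snd Q)}" for Q
    proof -
      have "{P :: 'a \<times> 'a \<times> real.
        inner (fst P) (fst (snd Q)) + inner (fst Q) (fst (snd P)) \<le> snd (snd P) + snd (snd Q)}
        = {P. inner (fst (snd Q), fst Q, -1) P \<le> snd (snd Q)}"
        by (auto simp: inner_prod_def inner_commute)
      thus ?thesis by (simp only: convex_halfspace_le)
    qed
    show ?thesis
    proof (rule hull_induct[OF that(2)[unfolded C_def]])
      fix Q assume Q: "Q \<in> (\<lambda>(a, u). (a, u, inner a u)) ` G"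
      show "inner (fst P) (fst (snd Q)) + inner (fst Q) (fst (snd P)) \<le> snd (snd P) + snd (snd Q)"
      proof (rule hull_induct[OF that(1)[unfolded C_def]])
        fix P assume "P \<in> (\<lambda>(a, u). (a, u, inner a u)) ` G"
        with Q show "inner (fst P) (fst (snd Q)) + inner (fst Q) (fst (snd P))
            \<le> snd (snd P) + snd (snd Q)"
          using mono by (force simp: inner_diff inner_commute)
      qed (rule cvx)
    next
      show "convex {Q. inner (fst P) (fst (snd Q)) + inner (fst Q) (fst (snd P))
            \<le> snd (snd P) + snd (snd Q)}"
        using cvx[of P] by (simp add: add.commute)
    qed
  qed
  \<comment> \<open>\<open>pair\<close> with both arguments equal to \<open>P\<close> gives
    \<open>inner a u \<le> s\<close>; what remains is minus a square.\<close>
  have g_le: "g P \<le> 0" if "P \<in> C" for P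
  proof -
    obtain a u s where P: "P = (a, u, s)" by (cases P)
    have "inner a u \<le> s" using pair[OF that that] by (simp add: P)
    moreover have "inner z a - inner a u - (norm ((1/2) *\<^sub>R (a - u + z)))\<^sup>2
        = - (norm ((1/2) *\<^sub>R (a - (z - u))))\<^sup>2"
      unfolding power2_norm_eq_inner by (simp add: algebra_simps inner_commute)
    ultimately show ?thesis
      using zero_le_power2[of "norm ((1/2) *\<^sub>R (a - (z - u)))"]
      unfolding g_def P m_def fst_conv snd_conv prod.case by linarith
  qed
  \<comment> \<open>Strong concavity of \<open>g\<close> in the direction of \<open>m\<close>, as an
    identity. With \<open>t = 1/2\<close> it makes \<open>m\<close> Cauchy along a maximising
    sequence.\<close>
  have g_comb: "g ((1 - t) *\<^sub>R P + t *\<^sub>R Q)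
      = (1 - t) * g P + t * g Q + t * (1 - t) * (norm (m P - m Q))\<^sup>2" for t P Q
  proof -
    have lin: "m ((1 - t) *\<^sub>R P + t *\<^sub>R Q) = (1 - t) *\<^sub>R m P + t *\<^sub>R m Q"
    proof -
      obtain a u k where P: "P = (a, u, k)" by (cases P)
      obtain b w l where Q: "Q = (b, w, l)" by (cases Q)
      have "((1 - t) *\<^sub>R a + t *\<^sub>R b) - ((1 - t) *\<^sub>R u + t *\<^sub>R w) + z
          = (1 - t) *\<^sub>R (a - u + z) + t *\<^sub>R (b - w + z)"
        by (simp add: algebra_simps)
      thus ?thesis
        by (simp only: P Q m_def prod.case add_Pair scaleR_Pair scaleR_add_right[of "1/2" "(1 - t) *\<^sub>R _"]
              scaleR_left_commute[of "1/2"])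
    qed
    have "(norm ((1 - t) *\<^sub>R x + t *\<^sub>R y))\<^sup>2
        = (1 - t) * (norm x)\<^sup>2 + t * (norm y)\<^sup>2 - t * (1 - t) * (norm (x - y))\<^sup>2" for x y :: 'a
      unfolding power2_norm_eq_inner by (simp add: algebra_simps inner_commute)
    thus ?thesis unfolding g_def lin by (simp add: inner_add_right algebra_simps)
  qed
  define \<gamma> where "\<gamma> = Sup (g ` C)"
  have bdd: "bdd_above (g ` C)" using g_le by (auto intro!: bdd_aboveI2)
  have Cne: "C \<noteq> {}" using ne GC by fastforce
  have g\<gamma>: "g P \<le> \<gamma>" if "P \<in> C" for P unfolding \<gamma>_def by (intro cSUP_upper that bdd)
  have \<gamma>0: "\<gamma> \<le> 0" unfolding \<gamma>_def using Cne g_le by (intro cSUP_least)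
  have "\<exists>P\<in>C. \<gamma> - inverse (real (Suc n)) < g P" for n
  proof -
    have "\<gamma> - inverse (real (Suc n)) < Sup (g ` C)" unfolding \<gamma>_def by simp
    thus ?thesis using less_cSUP_iff[OF Cne bdd] by blast
  qed
  then obtain P where PC: "\<And>n. P n \<in> C" and P: "\<And>n. \<gamma> - inverse (real (Suc n)) < g (P n)"
    by metis
  have "(\<lambda>n. \<gamma> - inverse (real (Suc n))) \<longlonglongrightarrow> \<gamma>"
    using tendsto_diff[OF tendsto_const LIMSEQ_inverse_real_of_nat, of \<gamma>] by simp
  hence gP: "(\<lambda>n. g (P n)) \<longlonglongrightarrow> \<gamma>"
    by (rule tendsto_sandwich[OF _ _ _ tendsto_const, rotated 2])
       (use P PC g\<gamma> in \<open>auto simp: less_imp_le\<close>)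
  define e where "e n = 2 * (\<gamma> - g (P n))" for n
  have "(norm (m (P i) - m (P j)))\<^sup>2 \<le> e i + e j" for i j
  proof -
    have "(1 - 1/2) *\<^sub>R P i + (1/2) *\<^sub>R P j \<in> C"
      using PC by (intro convexD[OF convC]) auto
    from g\<gamma>[OF this, unfolded g_comb] show ?thesis by (simp add: e_def)
  qed
  moreover have "e \<longlonglongrightarrow> 2 * (\<gamma> - \<gamma>)" unfolding e_def by (intro tendsto_intros gP)
  ultimately obtain x where x: "(\<lambda>n. m (P n)) \<longlonglongrightarrow> x"
    using quadratic_Cauchy_limit[of "\<lambda>n. m (P n)" e] by auto
  show thesis
  proof (rule that)
    fix a u assume au: "(a, u) \<in> G"
    define Q where "Q = (a, u, inner a u)"
    have Q: "Q \<in> C" using GC[OF au] by (simp add: Q_def)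
    \<comment> \<open>First-order optimality: move from the maximising sequence towards
      \<open>Q\<close> with weight \<open>t\<close>, pass to the limit and divide by
      \<open>t\<close>. Afterwards \<open>t\<close> tends to 0.\<close>
    have step: "g Q + (1 - t) * (norm (x - m Q))\<^sup>2 \<le> \<gamma>" if t: "0 < t" "t < 1" for t
    proof -
      have "(1 - t) * g (P n) + t * g Q + t * (1 - t) * (norm (m (P n) - m Q))\<^sup>2 \<le> \<gamma>" for n
        unfolding g_comb[symmetric] using t PC Q
        by (intro g\<gamma> convexD[OF convC]) auto
      moreover have "(\<lambda>n. (1 - t) * g (P n) + t * g Q + t * (1 - t) * (norm (m (P n) - m Q))\<^sup>2)
          \<longlonglongrightarrow> (1 - t) * \<gamma> + t * g Q + t * (1 - t) * (norm (x - m Q))\<^sup>2"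
        by (intro tendsto_intros gP x)
      ultimately have "(1 - t) * \<gamma> + t * g Q + t * (1 - t) * (norm (x - m Q))\<^sup>2 \<le> \<gamma>"
        by (intro LIMSEQ_le_const2) auto
      hence "t * (g Q + (1 - t) * (norm (x - m Q))\<^sup>2) \<le> t * \<gamma>" by (simp add: algebra_simps)
      thus ?thesis using t by simp
    qed
    have "(\<lambda>n. g Q + (1 - inverse (real (Suc (Suc n)))) * (norm (x - m Q))\<^sup>2)
        \<longlonglongrightarrow> g Q + (1 - 0) * (norm (x - m Q))\<^sup>2"
      by (intro tendsto_intros LIMSEQ_Suc[OF LIMSEQ_inverse_real_of_nat])
    moreover have "g Q + (1 - inverse (real (Suc (Suc n)))) * (norm (x - m Q))\<^sup>2 \<le> \<gamma>" for n
      by (intro step) (auto simp: field_simps)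
    ultimately have "g Q + (norm (x - m Q))\<^sup>2 \<le> \<gamma>"
      using LIMSEQ_le_const2 by (metis (no_types, lifting) diff_zero mult_1)
    hence "g Q + (norm (x - m Q))\<^sup>2 \<le> 0" using \<gamma>0 by simp
    moreover have "g Q + (norm (x - m Q))\<^sup>2 = - inner (u - (z - x)) (a - x)"
      unfolding g_def Q_def m_def power2_norm_eq_inner by (simp add: algebra_simps inner_commute)
    ultimately show "inner (u - (z - x)) (a - x) \<ge> 0" by simp
  qed
qed

text \<open>Otherwise adding the pair \<open>(x, y)\<close> to the graph would give a strictly
  larger monotone operator.\<close>

lemma maximal_monotone_op_mem:
  assumes S: "maximal_monotone_op S"
    and rel: "\<And>a u. u \<in> S a \<Longrightarrow> inner (u - y) (a - x) \<ge> 0"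
  shows "y \<in> S x"
proof (rule ccontr)
  assume n: "y \<notin> S x"
  define B where "B = S(x := insert y (S x))"
  have "monotone_op B"
    unfolding monotone_op_def
  proof (intro allI ballI)
    fix a b u t assume "u \<in> B a" "t \<in> B b"
    hence "(u \<in> S a \<or> (a = x \<and> u = y))" "(t \<in> S b \<or> (b = x \<and> t = y))"
      by (auto simp: B_def split: if_splits)
    moreover have "inner (y - t) (x - b) \<ge> 0" if "t \<in> S b"
    proof -
      have "inner (y - t) (x - b) = inner (t - y) (b - x)"
        by (simp add: algebra_simps)
      thus ?thesis using rel[OF that] by simp
    qed
    ultimately show "inner (u - t) (a - b) \<ge> 0"
      using S rel by (auto simp: maximal_monotone_op_def monotone_op_def)
  qed
  moreover have "op_graph S \<subset> op_graph B"
  proof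
    show "op_graph S \<subseteq> op_graph B" by (auto simp: op_graph_def B_def)
    show "op_graph S \<noteq> op_graph B" using n by (auto simp: op_graph_def B_def)
  qed
  ultimately show False using S unfolding maximal_monotone_op_def by blast
qed

text \<open>For the graph of \<open>d S\<close>, \<open>monotone_set_extension\<close> finds
  \<open>x\<close> such that \<open>(x, z - x)\<close> is monotonically related to every pair; after
  division by \<open>d\<close>, maximality of \<open>S\<close> turns this into membership.\<close>

lemma Minty:
  fixes S :: "'a::{real_inner, complete_space} \<Rightarrow> 'a set"
  assumes S: "maximal_monotone_op S" and d: "d > 0"
  obtains x u where "u \<in> S x" "x + d *\<^sub>R u = z"
proof -
  define G where "G = {(a, d *\<^sub>R u) | a u. u \<in> S a}"
  \<comment> \<open>The empty operator is not maximal: the membership test holds vacuously and would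
    put 0 into \<open>S 0\<close>.\<close>
  have "G \<noteq> {}"
  proof
    assume "G = {}"
    hence "S a = {}" for a by (auto simp: G_def)
    hence "0 \<in> S 0" by (intro maximal_monotone_op_mem[OF S]) auto
    with \<open>\<And>a. S a = {}\<close> show False by simp
  qed
  moreover have "inner (u - t) (a - b) \<ge> 0" if "(a, u) \<in> G" "(b, t) \<in> G" for a u b t
    using that S d
    by (auto simp: G_def maximal_monotone_op_def monotone_op_def simp flip: scaleR_diff_right)
  ultimately obtain x where x: "\<And>a u. (a, u) \<in> G \<Longrightarrow> inner (u - (z - x)) (a - x) \<ge> 0"
    using monotone_set_extension[of G z] by blast
  have "(1/d) *\<^sub>R (z - x) \<in> S x"
  proof (rule maximal_monotone_op_mem[OF S])
    fix a u assume "u \<in> S a"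
    hence "inner (d *\<^sub>R u - (z - x)) (a - x) \<ge> 0" by (intro x) (auto simp: G_def)
    also have "d *\<^sub>R u - (z - x) = d *\<^sub>R (u - (1/d) *\<^sub>R (z - x))"
      using d by (simp add: algebra_simps)
    finally show "inner (u - (1/d) *\<^sub>R (z - x)) (a - x) \<ge> 0"
      using d by (simp add: zero_le_mult_iff)
  qed
  moreover have "x + d *\<^sub>R ((1/d) *\<^sub>R (z - x)) = z" using d by simp
  ultimately show thesis using that by blast
qed

text \<open>Existence is Minty's theorem. Two solutions satisfy
  \<open>d *\<^sub>R (t - u) = - (y - x)\<close>, which monotonicity allows only for
  \<open>y = x\<close>, so \<open>the_elem\<close> is applied to a singleton.\<close>

lemma resolvent_mem:
  fixes S :: "'a::{real_inner, complete_space} \<Rightarrow> 'a set"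
  assumes S: "maximal_monotone_op S" and d: "d > 0"
  shows "(1/d) *\<^sub>R (z - resolvent d S z) \<in> S (resolvent d S z)"
proof -
  obtain x u where u: "u \<in> S x" "x + d *\<^sub>R u = z" using Minty[OF assms] .
  have "y = x" if t: "t \<in> S y" "y + d *\<^sub>R t = z" for y t
  proof -
    have "inner (t - u) (y - x) \<ge> 0"
      using S u(1) t(1) by (auto simp: maximal_monotone_op_def monotone_op_def)
    hence "0 \<le> inner (d *\<^sub>R (t - u)) (y - x)" using d by simp
    also have "d *\<^sub>R (t - u) = - (y - x)" using t(2) u(2) by (auto simp: algebra_simps)
    finally have "inner (y - x) (y - x) \<le> 0" by (simp only: inner_minus_left neg_0_le_iff_le)
    hence "inner (y - x) (y - x) = 0" by (intro antisym inner_ge_zero)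
    thus ?thesis by simp
  qed
  hence "op_inverse (\<lambda>x. (\<lambda>u. x + d *\<^sub>R u) ` S x) z = {x}"
    using u by (force simp: op_inverse_def)
  hence "resolvent d S z = x" by (simp add: resolvent_def)
  moreover have "(1/d) *\<^sub>R (z - x) = u" using d u(2) by auto
  ultimately show ?thesis using u by simp
qed

lemma zeros_sum_iff: "p \<in> zeros_sum S T \<longleftrightarrow> - T p \<in> S p"
  by (auto simp: zeros_sum_def op_inverse_def image_iff add_eq_0_iff2)

text \<open>For \<open>t < 1 / L\<close>, comparing \<open>p\<close> with the resolvent step \<open>J\<^sub>t (p - t T p)\<close> forces the two
  to coincide.\<close>

lemma zeros_sum_iff_variational:
  fixes S :: "'a::{real_inner, complete_space} \<Rightarrow> 'a set"
  assumes S: "maximal_monotone_op S"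
    and T: "\<And>a b. inner (T a - T b) (a - b) \<ge> 0"
    and L: "L > 0" and lip: "L-lipschitz_on UNIV T"
  shows "p \<in> zeros_sum S T \<longleftrightarrow> (\<forall>a. \<forall>u\<in>S a. inner (u + T a) (a - p) \<ge> 0)"
proof
  assume p: "p \<in> zeros_sum S T"
  show "\<forall>a. \<forall>u\<in>S a. inner (u + T a) (a - p) \<ge> 0"
  proof (intro allI ballI)
    fix a u assume u: "u \<in> S a"
    have "inner (u - (- T p)) (a - p) \<ge> 0"
      using S u p unfolding maximal_monotone_op_def monotone_op_def zeros_sum_iff by blast
    with T[of a p] show "inner (u + T a) (a - p) \<ge> 0"
      by (simp add: inner_add_left inner_diff_left)
  qed
next
  assume var: "\<forall>a. \<forall>u\<in>S a. inner (u + T a) (a - p) \<ge> 0"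
  \<comment> \<open>With \<open>t * L = 1/2\<close> the Lipschitz term absorbs only half of the
    square of \<open>norm (a - p)\<close>.\<close>
  define t where "t = 1 / (2 * L)"
  have t: "t > 0" using L by (simp add: t_def)
  obtain a u where u: "u \<in> S a" "a + t *\<^sub>R u = p - t *\<^sub>R T p" using Minty[OF S t] .
  have "t *\<^sub>R (u + T a) = (p - a) + t *\<^sub>R (T a - T p)"
    using u(2) by (simp add: algebra_simps)
  moreover have "0 \<le> inner (t *\<^sub>R (u + T a)) (a - p)" using var u t by simp
  ultimately have "0 \<le> inner ((p - a) + t *\<^sub>R (T a - T p)) (a - p)" by simp
  also have "\<dots> = t * inner (T a - T p) (a - p) - (norm (a - p))\<^sup>2"
    by (simp add: power2_norm_eq_inner algebra_simps)
  also have "\<dots> \<le> t * (L * (norm (a - p))\<^sup>2) - (norm (a - p))\<^sup>2"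
  proof -
    have "inner (T a - T p) (a - p) \<le> norm (T a - T p) * norm (a - p)" by (rule norm_cauchy_schwarz)
    also have "\<dots> \<le> (L * norm (a - p)) * norm (a - p)"
      using lipschitz_onD[OF lip, of a p] by (intro mult_right_mono) (auto simp: dist_norm)
    finally show ?thesis using t by (simp add: power2_eq_square mult_ac)
  qed
  also have "\<dots> = - (norm (a - p))\<^sup>2 / 2" using L by (simp add: t_def)
  finally have "a = p" by simp
  with u(2) have "t *\<^sub>R (u + T p) = 0" by (simp add: algebra_simps)
  hence "u = - T p" using t by (simp add: add_eq_0_iff2)
  thus "p \<in> zeros_sum S T" using u(1) \<open>a = p\<close> by (simp add: zeros_sum_iff)
qed

text \<open>The variational description writes the zero set as an intersection of closed
  half-spaces.\<close>

lemma zeros_sum_closed_convex: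
  fixes S :: "'a::{real_inner, complete_space} \<Rightarrow> 'a set"
  assumes "maximal_monotone_op S" "\<And>a b. inner (T a - T b) (a - b) \<ge> 0"
    and "L > 0" "L-lipschitz_on UNIV T"
  shows "closed (zeros_sum S T)" "convex (zeros_sum S T)"
proof -
  have "zeros_sum S T = (\<Inter>a. \<Inter>u\<in>S a. {p. inner (u + T a) p \<le> inner (u + T a) a})"
    using zeros_sum_iff_variational[OF assms] by (auto simp: inner_diff_right)
  thus "closed (zeros_sum S T)" "convex (zeros_sum S T)"
    by (auto intro!: closed_INT convex_INT closed_halfspace_le convex_halfspace_le)
qed

text \<open>If the inequality failed for every \<open>k\<close>, it would fail for a generalised
  weak limit \<open>x\<close> as well. Testing \<open>y k\<close> against the graph of
  \<open>S\<close>, with residuals \<open>R k\<close> tending to 0, shows that \<open>x\<close> is a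
  zero, against the projection inequality. A single \<open>k\<close> suffices because the lemma is
  applied to a sequence of supposed counterexamples.\<close>

lemma approximate_zeros_proj:
  fixes S :: "'a::{real_inner, complete_space} \<Rightarrow> 'a set"
  assumes S: "maximal_monotone_op S"
    and T: "\<And>a b. inner (T a - T b) (a - b) \<ge> 0"
    and L: "L > 0" and lip: "L-lipschitz_on UNIV T" and ne: "zeros_sum S T \<noteq> {}"
    and bd: "\<And>k. norm (y k) \<le> B" and R: "R \<longlonglongrightarrow> 0" and mem: "\<And>k. R k - T (y k) \<in> S (y k)"
    and \<epsilon>: "\<epsilon> > 0"
  shows "\<exists>k::nat. inner (v - metric_proj (zeros_sum S T) v) (y k - metric_proj (zeros_sum S T) v) \<le> \<epsilon>"
proof (rule ccontr)
  define p where "p = metric_proj (zeros_sum S T) v"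
  assume "\<not> ?thesis"
  hence large: "inner (v - p) (y k) \<ge> inner (v - p) p + \<epsilon>" for k
    by (auto simp: p_def not_le inner_diff_right less_imp_le algebra_simps)
  obtain x where x: "\<And>h c. (\<forall>\<^sub>F k in sequentially. inner h (y k) \<le> c) \<Longrightarrow> inner h x \<le> c"
    using bounded_seq_weak_point[of y B] bd by blast
  have "x \<in> zeros_sum S T"
    unfolding zeros_sum_iff_variational[OF S T L lip]
  proof (intro allI ballI)
    fix a u assume u: "u \<in> S a"
    have "inner (u + T a) x \<le> inner (u + T a) a + e" if e: "e > 0" for e
    proof (rule x)
      have "(\<lambda>k. norm (R k) * (norm a + B)) \<longlonglongrightarrow> norm (0::'a) * (norm a + B)"
        by (intro tendsto_intros R)
      hence "\<forall>\<^sub>F k in sequentially. norm (R k) * (norm a + B) < e"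
        using e by (intro order_tendstoD) auto
      thus "\<forall>\<^sub>F k in sequentially. inner (u + T a) (y k) \<le> inner (u + T a) a + e"
      proof eventually_elim
        case (elim k)
        have "inner (u - (R k - T (y k))) (a - y k) \<ge> 0"
          using S u mem[of k] unfolding maximal_monotone_op_def monotone_op_def by blast
        with T[of a "y k"] have "inner (R k) (a - y k) \<le> inner (u + T a) (a - y k)"
          by (simp add: inner_add_left inner_diff_left)
        moreover have "- inner (R k) (a - y k) \<le> norm (R k) * norm (a - y k)"
          using Cauchy_Schwarz_ineq2[of "R k" "a - y k"] by linarith
        moreover have "norm (R k) * norm (a - y k) \<le> norm (R k) * (norm a + B)"
          using norm_triangle_ineq4[of a "y k"] bd[of k] by (intro mult_left_mono) auto
        ultimately show ?case using elim by (simp add: inner_diff_right)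
      qed
    qed
    hence "inner (u + T a) x \<le> inner (u + T a) a" by (rule field_le_epsilon)
    thus "inner (u + T a) (a - x) \<ge> 0" by (simp add: inner_diff_right)
  qed
  hence "inner (v - p) (x - p) \<le> 0"
    unfolding p_def using zeros_sum_closed_convex[OF S T L lip] ne
    by (intro metric_proj_exists(2)) auto
  moreover have "inner (- (v - p)) x \<le> - (inner (v - p) p + \<epsilon>)"
    using large by (intro x) (simp only: inner_minus_left neg_le_iff_le eventually_True)
  ultimately show False using \<epsilon> by (simp only: inner_minus_left inner_diff_right)
qed

section \<open>Energy estimates and step sizes\<close>

text \<open>Read \<open>A\<close>, \<open>d\<close>, \<open>e\<close>, \<open>f\<close>,
  \<open>g\<close>, \<open>h\<close>, \<open>s\<close> as w_n - p, d_n, d_{n+1}, v - p, g_n,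
  g_{n+1}, \<sigma>_n. The choice of \<open>\<kappa>\<close> pays for the increment terms at both
  ends and leaves \<open>\<eta>\<close> to spare at each.\<close>

lemma inertial_energy_step:
  fixes A d e f g h :: "'a::real_inner"
  assumes "0 \<le> \<theta>" "0 \<le> s" "s \<le> 1" "0 \<le> r"
    and g: "norm g \<le> r * norm d"
    and \<kappa>: "\<kappa> = 2 * \<theta> + r + \<eta>" "\<kappa> + \<eta> \<le> (1 - s) * (1 - \<theta> - r)"
    and step: "0 \<le> inner (s *\<^sub>R f + (1 - s) *\<^sub>R (A + \<theta> *\<^sub>R d - g) - (A + e) + h) (A + e)"
  shows "(norm (A + e))\<^sup>2 - 2 * inner h (A + e) - \<theta> * (norm A)\<^sup>2 + \<kappa> * (norm e)\<^sup>2
    \<le> (1 - s) * ((norm A)\<^sup>2 - 2 * inner g A - \<theta> * (norm (A - d))\<^sup>2 + \<kappa> * (norm d)\<^sup>2)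
      + s * (2 * inner f (A + e)) - s * (norm (A + e))\<^sup>2
      - (1 - s) * \<eta> * (norm d)\<^sup>2 - \<eta> * (norm e)\<^sup>2"
proof -
  define Q where "Q = 2 * inner (A + \<theta> *\<^sub>R d - g) (A + e) - (norm (A + e))\<^sup>2"
  define P where "P = (norm A)\<^sup>2 - 2 * inner g A - \<theta> * (norm (A - d))\<^sup>2"
  have "- (2 * inner g e) \<le> 2 * (norm g * norm e)"
    using Cauchy_Schwarz_ineq2[of g e] by linarith
  also have "\<dots> \<le> 2 * (r * norm d * norm e)"
    using g by (intro mult_left_mono mult_right_mono) auto
  also have "\<dots> = r * (2 * norm d * norm e)" by simp
  also have "\<dots> \<le> r * ((norm d)\<^sup>2 + (norm e)\<^sup>2)"
    using \<open>0 \<le> r\<close> by (intro mult_left_mono sum_squares_bound)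
  finally have ge: "- (2 * inner g e) \<le> r * ((norm d)\<^sup>2 + (norm e)\<^sup>2)" .
  \<comment> \<open>Polarisation treats the product of \<open>d\<close> and \<open>A\<close>
    exactly; only the product of \<open>d\<close> and \<open>e\<close> is estimated, through this
    square.\<close>
  have "0 \<le> \<theta> * (norm (d - e))\<^sup>2" using \<open>0 \<le> \<theta>\<close> by simp
  with ge have Q: "Q \<le> P + \<theta> * (norm A)\<^sup>2 + (2 * \<theta> + r) * (norm d)\<^sup>2 - (1 - \<theta> - r) * (norm e)\<^sup>2"
    unfolding Q_def P_def power2_norm_eq_inner by (simp add: algebra_simps inner_commute)
  have "0 \<le> s * (2 * inner f (A + e)) + (1 - s) * (Q + (norm (A + e))\<^sup>2)
      - 2 * (norm (A + e))\<^sup>2 + 2 * inner h (A + e)"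
    using step unfolding Q_def power2_norm_eq_inner
    by (simp only: inner_add_left inner_diff_left inner_scaleR_left) (simp add: algebra_simps)
  hence "(norm (A + e))\<^sup>2 - 2 * inner h (A + e)
      \<le> s * (2 * inner f (A + e)) + (1 - s) * Q - s * (norm (A + e))\<^sup>2"
    by (simp add: algebra_simps)
  also have "(1 - s) * Q \<le> (1 - s) * (P + \<theta> * (norm A)\<^sup>2 + (2 * \<theta> + r) * (norm d)\<^sup>2
      - (1 - \<theta> - r) * (norm e)\<^sup>2)"
    using Q \<open>s \<le> 1\<close> by (intro mult_left_mono) auto
  also have "\<dots> = (1 - s) * (P + \<kappa> * (norm d)\<^sup>2) - (1 - s) * \<eta> * (norm d)\<^sup>2
      + (1 - s) * (\<theta> * (norm A)\<^sup>2) - (1 - s) * (1 - \<theta> - r) * (norm e)\<^sup>2"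
    by (simp add: \<kappa>(1) algebra_simps)
  finally have "(norm (A + e))\<^sup>2 - 2 * inner h (A + e) \<le> s * (2 * inner f (A + e))
      + ((1 - s) * (P + \<kappa> * (norm d)\<^sup>2) - (1 - s) * \<eta> * (norm d)\<^sup>2
      + (1 - s) * (\<theta> * (norm A)\<^sup>2) - (1 - s) * (1 - \<theta> - r) * (norm e)\<^sup>2) - s * (norm (A + e))\<^sup>2"
    by simp
  moreover have "(1 - s) * (\<theta> * (norm A)\<^sup>2) \<le> \<theta> * (norm A)\<^sup>2"
    using \<open>0 \<le> \<theta>\<close> \<open>0 \<le> s\<close> by (intro mult_left_le_one_le) (use \<open>s \<le> 1\<close> in auto)
  moreover have "(\<kappa> + \<eta>) * (norm e)\<^sup>2 \<le> (1 - s) * (1 - \<theta> - r) * (norm e)\<^sup>2"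
    using \<kappa>(2) by (intro mult_right_mono) auto
  ultimately show ?thesis unfolding P_def by (simp add: distrib_right)
qed

text \<open>The cross term and the inertial term together cost at most
  \<open>r + 2 * \<theta>\<close> times each of the squared norms of \<open>A\<close> and
  \<open>d\<close>; the former is at most one half, the latter is covered by
  \<open>\<kappa>\<close>.\<close>

lemma inertial_energy_lower:
  fixes A d g :: "'a::real_inner"
  assumes "0 \<le> \<theta>" "0 \<le> r" "norm g \<le> r * norm d" "r + 2 * \<theta> \<le> 1/2" "2 * \<theta> + r \<le> \<kappa>"
  shows "(norm A)\<^sup>2 / 2 \<le> (norm A)\<^sup>2 - 2 * inner g A - \<theta> * (norm (A - d))\<^sup>2 + \<kappa> * (norm d)\<^sup>2"
proof -
  have "2 * inner g A \<le> 2 * (norm g * norm A)"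
    using norm_cauchy_schwarz[of g A] by simp
  also have "\<dots> \<le> 2 * (r * norm d * norm A)"
    using assms by (intro mult_left_mono mult_right_mono) auto
  also have "\<dots> = r * (2 * norm d * norm A)" by simp
  also have "\<dots> \<le> r * ((norm d)\<^sup>2 + (norm A)\<^sup>2)"
    using \<open>0 \<le> r\<close> by (intro mult_left_mono sum_squares_bound)
  finally have 1: "2 * inner g A \<le> r * ((norm d)\<^sup>2 + (norm A)\<^sup>2)" .
  have "(norm (A - d))\<^sup>2 = 2 * (norm A)\<^sup>2 + 2 * (norm d)\<^sup>2 - (norm (A + d))\<^sup>2"
    unfolding power2_norm_eq_inner by (simp add: algebra_simps inner_commute)
  hence "(norm (A - d))\<^sup>2 \<le> 2 * (norm A)\<^sup>2 + 2 * (norm d)\<^sup>2" by simp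
  hence 2: "\<theta> * (norm (A - d))\<^sup>2 \<le> \<theta> * (2 * (norm A)\<^sup>2 + 2 * (norm d)\<^sup>2)"
    using assms(1) by (intro mult_left_mono)
  have "(r + 2 * \<theta>) * (norm A)\<^sup>2 \<le> 1/2 * (norm A)\<^sup>2" "(2 * \<theta> + r) * (norm d)\<^sup>2 \<le> \<kappa> * (norm d)\<^sup>2"
    using assms by (intro mult_right_mono; simp)+
  with 1 2 show ?thesis by (simp add: algebra_simps)
qed

text \<open>After subtracting \<open>\<epsilon>\<close>, step \<open>n\<close> contracts by
  \<open>1 - s n \<le> exp (- s n)\<close>; the accumulated factor is the exponential of minus a
  diverging partial sum.\<close>

lemma averaged_recursion_tendsto_0:
  fixes E s :: "nat \<Rightarrow> real"
  assumes nonneg: "\<forall>\<^sub>F n in sequentially. 0 \<le> E n"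
    and s: "\<And>n. n \<ge> 1 \<Longrightarrow> s n \<le> 1"
    and div: "filterlim (\<lambda>N. \<Sum>n=1..N. s n) at_top sequentially"
    and rec: "\<And>\<epsilon>. \<epsilon> > 0 \<Longrightarrow> \<forall>\<^sub>F n in sequentially. E (Suc n) \<le> (1 - s n) * E n + s n * \<epsilon>"
  shows "E \<longlonglongrightarrow> 0"
proof (rule order_tendstoI)
  fix a :: real assume "a < 0"
  with nonneg show "\<forall>\<^sub>F n in sequentially. a < E n" by (auto elim: eventually_mono)
next
  fix a :: real assume a: "0 < a"
  define \<epsilon> where "\<epsilon> = a / 2"
  define P where "P N = (\<Sum>n=1..N. s n)" for N
  obtain N where N: "\<And>n. n \<ge> N \<Longrightarrow> E (Suc n) \<le> (1 - s n) * E n + s n * \<epsilon>"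
    using rec[of \<epsilon>] a by (auto simp: \<epsilon>_def eventually_sequentially)
  define M where "M = max N 1"
  \<comment> \<open>The nonnegative bound \<open>B\<close> makes the sign of
    \<open>E n - \<epsilon>\<close> irrelevant.\<close>
  have contract: "E (Suc n) - \<epsilon> \<le> B * exp (- s n)" if "n \<ge> M" "E n - \<epsilon> \<le> B" "0 \<le> B" for n B
  proof -
    have "E (Suc n) - \<epsilon> \<le> (1 - s n) * (E n - \<epsilon>)"
      using N[of n] that by (simp add: M_def algebra_simps)
    also have "\<dots> \<le> (1 - s n) * B" using that s[of n] by (intro mult_left_mono) (auto simp: M_def)
    also have "\<dots> \<le> exp (- s n) * B"
      using exp_ge_add_one_self[of "- s n"] that by (intro mult_right_mono) auto
    finally show ?thesis by (simp add: mult.commute)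
  qed
  have bound: "E (Suc n) - \<epsilon> \<le> \<bar>E M - \<epsilon>\<bar> * exp (P (M - 1)) * exp (- P n)" if "n \<ge> M" for n
    using that
  proof (induction n rule: dec_induct)
    case base
    have "P M = P (M - 1) + s M" by (cases M) (auto simp: P_def M_def)
    hence "exp (P (M - 1)) * exp (- P M) = exp (- s M)" by (simp flip: exp_add)
    thus ?case using contract[of M "\<bar>E M - \<epsilon>\<bar>"] by (simp add: mult.assoc)
  next
    case (step n)
    have "P (Suc n) = P n + s (Suc n)" by (simp add: P_def)
    hence "exp (- P (Suc n)) = exp (- P n) * exp (- s (Suc n))" by (simp flip: exp_add)
    thus ?case using contract[OF _ step.IH] step.hyps by (simp add: mult.assoc)
  qed
  have "filterlim (\<lambda>n. - P n) at_bot sequentially"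
    using div by (simp add: P_def filterlim_uminus_at_bot)
  hence "(\<lambda>n. \<bar>E M - \<epsilon>\<bar> * exp (P (M - 1)) * exp (- P n)) \<longlonglongrightarrow> \<bar>E M - \<epsilon>\<bar> * exp (P (M - 1)) * 0"
    by (intro tendsto_intros filterlim_compose[OF exp_at_bot])
  hence "\<forall>\<^sub>F n in sequentially. \<bar>E M - \<epsilon>\<bar> * exp (P (M - 1)) * exp (- P n) < \<epsilon>"
    using a by (intro order_tendstoD) (auto simp: \<epsilon>_def)
  hence "\<forall>\<^sub>F n in sequentially. E (Suc n) < a"
    using eventually_ge_at_top[of M]
  proof eventually_elim
    case (elim n)
    show ?case using bound[OF elim(2)] elim(1) by (simp add: \<epsilon>_def)
  qed
  thus "\<forall>\<^sub>F n in sequentially. E n < a"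
    using eventually_sequentially_Suc[of "\<lambda>n. E n < a"] by blast
qed

text \<open>The Lipschitz bound keeps the quotient above \<open>r / L\<close>. Subtracting the
  partial sums of \<open>c\<close> from the steps leaves a decreasing sequence that is bounded
  below.\<close>

lemma adaptive_step_size:
  fixes T :: "'a::real_normed_vector \<Rightarrow> 'b::real_normed_vector"
  assumes L: "L > 0" and lip: "L-lipschitz_on UNIV T" and r: "r > 0" and \<delta>1: "\<delta> 1 > 0"
    and c: "\<And>n. n \<ge> 1 \<Longrightarrow> c n \<ge> 0" and summ: "summable (\<lambda>n. c (Suc n))"
    and rec: "\<And>n. n \<ge> 1 \<Longrightarrow>
           \<delta> (n + 1) =
             (if T (w n) \<noteq> T (w (n + 1))
              then min (r * norm (w n - w (n + 1)) / norm (T (w n) - T (w (n + 1)))) (\<delta> n + c n)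
              else \<delta> n + c n)"
  shows "\<And>n. n \<ge> 1 \<Longrightarrow> \<delta> n \<ge> min (\<delta> 1) (r / L)"
    and "\<And>n. n \<ge> 1 \<Longrightarrow> \<delta> (n + 1) * norm (T (w (n + 1)) - T (w n)) \<le> r * norm (w (n + 1) - w n)"
    and "convergent \<delta>"
proof -
  have lipn: "norm (T x - T y) \<le> L * norm (x - y)" for x y
    using lipschitz_onD[OF lip, of x y] by (simp add: dist_norm)
  show lower: "\<delta> n \<ge> min (\<delta> 1) (r / L)" if "n \<ge> 1" for n
    using that
  proof (induction n rule: dec_induct)
    case (step n)
    have "r / L \<le> r * norm (w n - w (n + 1)) / norm (T (w n) - T (w (n + 1)))"
      if "T (w n) \<noteq> T (w (n + 1))"
      using lipn[of "w n" "w (n + 1)"] that L r by (simp add: field_simps)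
    thus ?case using rec[of n] c[of n] step by auto
  qed simp
  show "\<delta> (n + 1) * norm (T (w (n + 1)) - T (w n)) \<le> r * norm (w (n + 1) - w n)" if "n \<ge> 1" for n
  proof (cases "T (w n) = T (w (n + 1))")
    case False
    hence "\<delta> (n + 1) \<le> r * norm (w n - w (n + 1)) / norm (T (w n) - T (w (n + 1)))"
      using rec[OF that] by simp
    thus ?thesis using False by (simp add: field_simps norm_minus_commute)
  qed (use r in simp)
  define y where "y n = \<delta> (Suc n) - (\<Sum>k<n. c (Suc k))" for n
  have "decseq y"
    unfolding decseq_Suc_iff using rec[of "Suc _"] by (auto simp: y_def)
  moreover have "min (\<delta> 1) (r / L) - (\<Sum>k. c (Suc k)) \<le> y n" for n
    using lower[of "Suc n"] sum_le_suminf[OF summ, of "{..<n}"] c by (simp add: y_def)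
  ultimately obtain l where "y \<longlonglongrightarrow> l" using decseq_convergent by blast
  hence "(\<lambda>n. y n + (\<Sum>k<n. c (Suc k))) \<longlonglongrightarrow> l + (\<Sum>k. c (Suc k))"
    using summable_LIMSEQ[OF summ] by (intro tendsto_add)
  hence "(\<lambda>n. \<delta> (Suc n)) \<longlonglongrightarrow> l + (\<Sum>k. c (Suc k))" by (simp add: y_def)
  thus "convergent \<delta>" by (auto simp: convergent_def dest: LIMSEQ_imp_Suc)
qed

section \<open>Strong convergence\<close>

theorem theorem4p3:
  fixes S :: "'a::{real_inner, complete_space} \<Rightarrow> 'a set"
    and T :: "'a \<Rightarrow> 'a"
    and L \<theta> \<beta> r :: real
    and \<sigma> c \<delta> :: "nat \<Rightarrow> real"
    and v :: 'a
    and w :: "nat \<Rightarrow> 'a"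
  assumes "maximal_monotone_op S"
    and "\<And>a b. inner (T a - T b) (a - b) \<ge> 0"
    and "L > 0"
    and "L-lipschitz_on UNIV T"
    and "zeros_sum S T \<noteq> {}"
    and "\<delta> 0 > 0" and "\<delta> 1 > 0"
    and "\<theta> \<in> {0..<1}"
    and "\<beta> \<in> {0<..<1/4}"
    and "r \<in> {\<beta><..<(1 - 2 * \<beta>) / 2}"
    and "\<And>n. n \<ge> 1 \<Longrightarrow> \<sigma> n \<in> {0<..<1}"
    and "\<And>n. n \<ge> 1 \<Longrightarrow> c n \<ge> 0"
    and "summable (\<lambda>n. c (Suc n))"
    and "\<And>n. n \<ge> 1 \<Longrightarrow>
           w (n + 1) = resolvent (\<delta> n) S
             (\<sigma> n *\<^sub>R v + (1 - \<sigma> n) *\<^sub>R (w n + \<theta> *\<^sub>R (w n - w (n - 1)))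
               - \<delta> n *\<^sub>R T (w n)
               - (\<delta> (n - 1) * (1 - \<sigma> n)) *\<^sub>R (T (w n) - T (w (n - 1))))"
    and "\<And>n. n \<ge> 1 \<Longrightarrow>
           \<delta> (n + 1) =
             (if T (w n) \<noteq> T (w (n + 1))
              then min (r * norm (w n - w (n + 1)) / norm (T (w n) - T (w (n + 1)))) (\<delta> n + c n)
              else \<delta> n + c n)"
    and "0 \<le> \<theta>" and "\<theta> < min (\<beta> / 2) ((1/2 - r) / 2)"
    and "\<sigma> \<longlonglongrightarrow> 0"
    and "filterlim (\<lambda>N. \<Sum>n=1..N. \<sigma> n) at_top sequentially"
  shows "w \<longlonglongrightarrow> metric_proj (zeros_sum S T) v"
proof -
  note S = assms(1) and T = assms(2) and L = assms(3) and lip = assms(4)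
  define p where "p = metric_proj (zeros_sum S T) v"
  have p: "p \<in> zeros_sum S T"
    unfolding p_def using zeros_sum_closed_convex[OF S T L lip] assms(5)
    by (intro metric_proj_exists(1))

  \<comment> \<open>Step sizes and their positive limit\<close>
  have r: "r > 0" using assms(9,10) by auto
  have \<theta>: "0 \<le> \<theta>" "4 * \<theta> < 1 - 2 * r" using assms(16,17) by (auto simp: field_simps)
  have s01: "0 < \<sigma> n" "\<sigma> n < 1" if "n \<ge> 1" for n using assms(11)[OF that] by auto
  define \<delta>0 where "\<delta>0 = min (\<delta> 1) (r / L)"
  have \<delta>0: "\<delta>0 > 0" using r L assms(7) by (simp add: \<delta>0_def)
  have \<delta>_ge: "\<delta>0 \<le> \<delta> n" if "n \<ge> 1" for n
    unfolding \<delta>0_def using that by (intro adaptive_step_size(1)[OF L lip r assms(7,12,13,15)])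
  have \<delta>_T: "\<delta> (n + 1) * norm (T (w (n + 1)) - T (w n)) \<le> r * norm (w (n + 1) - w n)"
    if "n \<ge> 1" for n
    using that by (intro adaptive_step_size(2)[OF L lip r assms(7,12,13,15)])
  have conv: "convergent \<delta>" by (rule adaptive_step_size(3)[OF L lip r assms(7,12,13,15)])
  obtain \<delta>l where \<delta>l: "\<delta> \<longlonglongrightarrow> \<delta>l" using conv by (auto simp: convergent_def)
  have "\<delta>0 \<le> \<delta>l" using \<delta>l \<delta>_ge by (intro LIMSEQ_le_const) auto
  with \<delta>0 have \<delta>l_pos: "\<delta>l > 0" by simp

  \<comment> \<open>An eighth of the slack in \<open>4 * \<theta> < 1 - 2 * r\<close>: then
    \<open>r' + 2 * \<theta>\<close> equals \<open>1/2 - 3 * \<eta>\<close>, and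
    \<open>\<kappa> + \<eta> + \<theta> + r'\<close> equals
    \<open>1 - \<theta> - 4 * \<eta>\<close>.\<close>
  define \<eta> where "\<eta> = (1 - 2 * r - 4 * \<theta>) / 8"
  define r' where "r' = r + \<eta>"
  define \<kappa> where "\<kappa> = 2 * \<theta> + r' + \<eta>"
  have \<eta>8: "8 * \<eta> = 1 - 2 * r - 4 * \<theta>" by (simp add: \<eta>_def)
  with \<theta> have \<eta>: "\<eta> > 0" by linarith
  have r': "0 < r'" "r < r'" using r \<eta> by (auto simp: r'_def)
  have r'\<theta>: "r' + 2 * \<theta> \<le> 1/2" using \<theta> \<eta>8 unfolding r'_def by linarith
  have \<kappa>\<eta>: "\<kappa> + \<eta> < 1 - \<theta> - r'" using \<theta> \<eta>8 unfolding \<kappa>_def r'_def by linarith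

  \<comment> \<open>Energy and residual\<close>
  define d where "d n = w n - w (n - 1)" for n
  define A where "A n = w n - p" for n
  define g where "g n = \<delta> (n - 1) *\<^sub>R (T (w n) - T (w (n - 1)))" for n
  define E where "E n = (norm (A n))\<^sup>2 - 2 * inner (g n) (A n) - \<theta> * (norm (A n - d n))\<^sup>2
    + \<kappa> * (norm (d n))\<^sup>2" for n
  \<comment> \<open>\<open>R n\<close> is an element of (S + T) at \<open>w (n + 1)\<close>; the
    summand \<open>g (n + 1)\<close> exchanges the forward value \<open>T (w n)\<close> for
    \<open>T (w (n + 1))\<close>.\<close>
  define R where "R n = (1 / \<delta> n) *\<^sub>R (\<sigma> n *\<^sub>R v + (1 - \<sigma> n) *\<^sub>R (w n + \<theta> *\<^sub>R d n - g n)
    - w (n + 1) + g (n + 1))" for n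
  have R_mem: "R n - T (w (n + 1)) \<in> S (w (n + 1))" if n: "n \<ge> 1" for n
  proof -
    define z where "z = \<sigma> n *\<^sub>R v + (1 - \<sigma> n) *\<^sub>R (w n + \<theta> *\<^sub>R (w n - w (n - 1)))
               - \<delta> n *\<^sub>R T (w n) - (\<delta> (n - 1) * (1 - \<sigma> n)) *\<^sub>R (T (w n) - T (w (n - 1)))"
    have pos: "\<delta> n > 0" using \<delta>_ge[OF n] \<delta>0 by simp
    have "(1 / \<delta> n) *\<^sub>R (z - w (n + 1)) \<in> S (w (n + 1))"
      using resolvent_mem[OF S pos, of z] assms(14)[OF n] by (simp add: z_def)
    also have "z - w (n + 1) = \<sigma> n *\<^sub>R v + (1 - \<sigma> n) *\<^sub>R (w n + \<theta> *\<^sub>R d n - g n)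
        - w (n + 1) + g (n + 1) - \<delta> n *\<^sub>R T (w (n + 1))"
      by (simp add: z_def d_def g_def scaleR_diff_right scaleR_add_right mult.commute)
    also have "(1 / \<delta> n) *\<^sub>R \<dots> = R n - T (w (n + 1))"
      unfolding R_def using pos by (simp only: scaleR_diff_right) simp
    finally show ?thesis .
  qed

  have ev_g: "\<forall>\<^sub>F n in sequentially. norm (g n) \<le> r' * norm (d n)"
  proof -
    \<comment> \<open>The step rule controls \<open>\<delta> (n + 2)\<close> times the difference of
      \<open>T\<close>, whereas \<open>g (n + 2)\<close> carries \<open>\<delta> (n + 1)\<close>.
      The quotient of successive steps tends to 1, so \<open>r\<close> only grows to
      \<open>r'\<close>.\<close>
    have "(\<lambda>n. \<delta> (n + 1) * r / \<delta> (n + 2)) \<longlonglongrightarrow> \<delta>l * r / \<delta>l"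
      using \<delta>l_pos by (intro tendsto_intros LIMSEQ_ignore_initial_segment[OF \<delta>l]) auto
    hence "\<forall>\<^sub>F n in sequentially. \<delta> (n + 1) * r / \<delta> (n + 2) < r'"
      by (rule order_tendstoD(2)) (use r' \<delta>l_pos in simp)
    hence "\<forall>\<^sub>F n in sequentially. norm (g (n + 2)) \<le> r' * norm (d (n + 2))"
    proof eventually_elim
      case (elim n)
      have pos: "\<delta> (n + 1) > 0" "\<delta> (n + 2) > 0" using \<delta>_ge[of "n + 1"] \<delta>_ge[of "n + 2"] \<delta>0 by auto
      have T_le: "norm (T (w (n + 2)) - T (w (n + 1))) \<le> r * norm (d (n + 2)) / \<delta> (n + 2)"
        using \<delta>_T[of "n + 1"] pos by (simp add: field_simps d_def)
      have "norm (g (n + 2)) = \<delta> (n + 1) * norm (T (w (n + 2)) - T (w (n + 1)))"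
        using pos by (simp add: g_def)
      also have "\<dots> \<le> \<delta> (n + 1) * (r * norm (d (n + 2)) / \<delta> (n + 2))"
        by (rule mult_left_mono[OF T_le]) (use pos in simp)
      also have "\<dots> = \<delta> (n + 1) * r / \<delta> (n + 2) * norm (d (n + 2))" by simp
      also have "\<dots> \<le> r' * norm (d (n + 2))" using elim by (intro mult_right_mono) auto
      finally show ?case .
    qed
    thus ?thesis using eventually_sequentially_seg[of _ 2] by blast
  qed
  have "(\<lambda>n. (1 - \<sigma> n) * (1 - \<theta> - r')) \<longlonglongrightarrow> (1 - 0) * (1 - \<theta> - r')"
    by (intro tendsto_intros assms(18))
  hence ev_\<kappa>: "\<forall>\<^sub>F n in sequentially. \<kappa> + \<eta> < (1 - \<sigma> n) * (1 - \<theta> - r')"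
    by (rule order_tendstoD(1)) (use \<kappa>\<eta> in simp)
  have ev_\<sigma>: "\<forall>\<^sub>F n in sequentially. \<sigma> n < 1/2"
    by (rule order_tendstoD[OF assms(18)]) simp
  have "\<forall>\<^sub>F n in sequentially. n \<ge> 1 \<and> norm (g n) \<le> r' * norm (d n)
      \<and> \<kappa> + \<eta> < (1 - \<sigma> n) * (1 - \<theta> - r') \<and> \<sigma> n < 1/2"
    using ev_g ev_\<kappa> ev_\<sigma> eventually_ge_at_top[of "1::nat"] by eventually_elim simp
  then obtain N where N: "\<And>n. n \<ge> N \<Longrightarrow> n \<ge> 1 \<and> norm (g n) \<le> r' * norm (d n)
      \<and> \<kappa> + \<eta> < (1 - \<sigma> n) * (1 - \<theta> - r') \<and> \<sigma> n < 1/2"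
    by (auto simp: eventually_sequentially)

  have E_lower: "(norm (A n))\<^sup>2 / 2 \<le> E n" if "n \<ge> N" for n
    unfolding E_def using N[OF that] \<theta> r' r'\<theta> \<eta>
    by (intro inertial_energy_lower[of _ r']) (auto simp: \<kappa>_def)
  have E_step: "E (Suc n) \<le> (1 - \<sigma> n) * E n + \<sigma> n * (2 * inner (v - p) (A (Suc n)))
      - \<sigma> n * (norm (A (Suc n)))\<^sup>2 - (1 - \<sigma> n) * \<eta> * (norm (d n))\<^sup>2 - \<eta> * (norm (d (Suc n)))\<^sup>2"
    if "n \<ge> N" for n
  proof -
    have n: "n \<ge> 1" using N[OF that] by simp
    have A_Suc: "A (Suc n) = A n + d (Suc n)" by (simp add: A_def d_def)
    have pos: "\<delta> n > 0" using \<delta>_ge[OF n] \<delta>0 by simp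
    \<comment> \<open>The variational inequality for \<open>p\<close>, tested at the pair supplied
      by \<open>R_mem\<close>.\<close>
    have "inner (R n) (A (Suc n)) \<ge> 0"
      using p R_mem[OF n] unfolding zeros_sum_iff_variational[OF S T L lip]
      by (force simp: A_def)
    hence "0 \<le> inner (\<delta> n *\<^sub>R R n) (A (Suc n))" using pos by simp
    also have "\<delta> n *\<^sub>R R n = \<sigma> n *\<^sub>R (v - p) + (1 - \<sigma> n) *\<^sub>R (A n + \<theta> *\<^sub>R d n - g n)
        - (A n + d (Suc n)) + g (Suc n)"
      using pos unfolding A_Suc[symmetric] by (simp add: R_def A_def algebra_simps)
    finally show ?thesis
      unfolding E_def A_Suc add_diff_cancel_right'
      using \<theta> r' N[OF that] s01[OF n] by (intro inertial_energy_step[where r = r']) (auto simp: \<kappa>_def)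
  qed

  \<comment> \<open>Boundedness of the iterates\<close>
  define M where "M = max (E N) ((norm (v - p))\<^sup>2)"
  have E_le: "E n \<le> M" if "n \<ge> N" for n
    using that
  proof (induction n rule: dec_induct)
    case (step n)
    have n: "n \<ge> 1" using N step.hyps by auto
    \<comment> \<open>The square of \<open>norm (A (Suc n))\<close> produced here cancels against
      the negative term in \<open>E_step\<close>, leaving a convex combination of \<open>E n\<close>
      and a constant.\<close>
    have "2 * inner (v - p) (A (Suc n)) \<le> (norm (v - p))\<^sup>2 + (norm (A (Suc n)))\<^sup>2"
      using zero_le_power2[of "norm (v - p - A (Suc n))"]
      unfolding power2_norm_eq_inner by (simp add: algebra_simps inner_commute)
    hence "\<sigma> n * (2 * inner (v - p) (A (Suc n))) \<le> \<sigma> n * ((norm (v - p))\<^sup>2 + (norm (A (Suc n)))\<^sup>2)"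
      using s01[OF n] by (intro mult_left_mono) auto
    moreover have "0 \<le> (1 - \<sigma> n) * \<eta> * (norm (d n))\<^sup>2" "0 \<le> \<eta> * (norm (d (Suc n)))\<^sup>2"
      using s01[OF n] \<eta> by auto
    ultimately have "E (Suc n) \<le> (1 - \<sigma> n) * E n + \<sigma> n * (norm (v - p))\<^sup>2"
      using E_step[of n] step.hyps by (simp add: distrib_left)
    also have "\<dots> \<le> (1 - \<sigma> n) * M + \<sigma> n * M"
      using s01[OF n] step.IH by (intro add_mono mult_left_mono) (auto simp: M_def)
    finally show ?case by (simp add: algebra_simps)
  qed (simp add: M_def)
  define B where "B = sqrt (2 * M)"
  have A_le: "norm (A n) \<le> B" if "n \<ge> N" for n
    unfolding B_def using E_lower[OF that] E_le[OF that] by (intro real_le_rsqrt) simp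
  have B_nonneg: "B \<ge> 0" using A_le[of N] norm_ge_zero[of "A N"] by linarith

  \<comment> \<open>Residual bounded by the anchor weight and two increments\<close>
  obtain D where D: "\<And>n. norm (\<delta> n) \<le> D"
    using Bseq_def[of \<delta>] convergent_imp_Bseq[OF conv] by auto
  have R_le: "norm (R n) \<le> (1 / \<delta>0) * (\<sigma> n * (norm (v - p) + B) + 2 * norm (d n)
      + (1 + D * L) * norm (d (Suc n)))" if "n \<ge> N" for n
  proof -
    have n: "n \<ge> 1" using N[OF that] by simp
    have pos: "\<delta> n > 0" using \<delta>_ge[OF n] \<delta>0 by simp
    have "\<delta> n *\<^sub>R R n = \<sigma> n *\<^sub>R (v - p - A n) + (1 - \<sigma> n) *\<^sub>R (\<theta> *\<^sub>R d n - g n)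
        - d (Suc n) + g (Suc n)"
      using pos by (simp add: R_def A_def d_def algebra_simps)
    hence "norm (\<delta> n *\<^sub>R R n) \<le> \<sigma> n * norm (v - p - A n) + (1 - \<sigma> n) * norm (\<theta> *\<^sub>R d n - g n)
        + norm (d (Suc n)) + norm (g (Suc n))"
      using s01[OF n] norm_triangle_ineq[of "\<sigma> n *\<^sub>R (v - p - A n)" "(1 - \<sigma> n) *\<^sub>R (\<theta> *\<^sub>R d n - g n)"]
        norm_triangle_ineq4[of "\<sigma> n *\<^sub>R (v - p - A n) + (1 - \<sigma> n) *\<^sub>R (\<theta> *\<^sub>R d n - g n)" "d (Suc n)"]
        norm_triangle_ineq[of "\<sigma> n *\<^sub>R (v - p - A n) + (1 - \<sigma> n) *\<^sub>R (\<theta> *\<^sub>R d n - g n) - d (Suc n)" "g (Suc n)"]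
      by simp
    moreover have "\<sigma> n * norm (v - p - A n) \<le> \<sigma> n * (norm (v - p) + B)"
      using norm_triangle_ineq4[of "v - p" "A n"] A_le[OF that] s01[OF n] by (intro mult_left_mono) auto
    moreover have "(1 - \<sigma> n) * norm (\<theta> *\<^sub>R d n - g n) \<le> 2 * norm (d n)"
    proof -
      have "(1 - \<sigma> n) * norm (\<theta> *\<^sub>R d n - g n) \<le> norm (\<theta> *\<^sub>R d n - g n)"
        using s01[OF n] by (intro mult_left_le_one_le) auto
      also have "\<dots> \<le> \<theta> * norm (d n) + r' * norm (d n)"
        using norm_triangle_ineq4[of "\<theta> *\<^sub>R d n" "g n"] N[OF that] \<theta> by simp
      also have "\<dots> \<le> 2 * norm (d n)"
        using r'\<theta> \<theta> by (simp flip: distrib_right add: mult_right_mono)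
      finally show ?thesis .
    qed
    moreover have "norm (g (Suc n)) \<le> D * (L * norm (d (Suc n)))"
      unfolding g_def d_def norm_scaleR using D[of n] lipschitz_onD[OF lip, of "w (Suc n)" "w n"]
      by (intro mult_mono) (auto simp: dist_norm intro: order_trans[OF norm_ge_zero])
    ultimately have "\<delta> n * norm (R n) \<le> \<sigma> n * (norm (v - p) + B) + 2 * norm (d n)
        + (1 + D * L) * norm (d (Suc n))"
      using pos by (simp add: distrib_right)
    moreover have "\<delta>0 * norm (R n) \<le> \<delta> n * norm (R n)"
      using \<delta>_ge[OF n] by (intro mult_right_mono) auto
    ultimately show ?thesis using \<delta>0 by (simp add: field_simps)
  qed

  \<comment> \<open>Small increments make the anchor term small\<close>
  have key: "\<exists>\<xi>>0. \<forall>\<^sub>F n in sequentially. (norm (d n))\<^sup>2 + (norm (d (Suc n)))\<^sup>2 \<le> \<xi>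
      \<longrightarrow> 2 * inner (v - p) (A (Suc n)) \<le> \<epsilon>" if \<epsilon>: "\<epsilon> > 0" for \<epsilon>
  proof (rule ccontr)
    assume neg: "\<not> ?thesis"
    \<comment> \<open>Counterexamples for shrinking thresholds, taken beyond \<open>N + k\<close> so
      that their indices tend to infinity and the anchor weights along them vanish as well.\<close>
    have "\<exists>n. n \<ge> N + k \<and> (norm (d n))\<^sup>2 + (norm (d (Suc n)))\<^sup>2 \<le> (inverse (real (Suc k)))\<^sup>2
      \<and> 2 * inner (v - p) (A (Suc n)) > \<epsilon>" for k
    proof (rule ccontr)
      assume "\<not> ?thesis"
      hence "\<forall>\<^sub>F n in sequentially. (norm (d n))\<^sup>2 + (norm (d (Suc n)))\<^sup>2 \<le> (inverse (real (Suc k)))\<^sup>2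
          \<longrightarrow> 2 * inner (v - p) (A (Suc n)) \<le> \<epsilon>"
        unfolding eventually_sequentially by (meson not_le)
      moreover have "(inverse (real (Suc k)))\<^sup>2 > 0" by simp
      ultimately show False using neg by blast
    qed
    then obtain \<nu> where \<nu>: "\<And>k. \<nu> k \<ge> N + k"
      and \<nu>d: "\<And>k. (norm (d (\<nu> k)))\<^sup>2 + (norm (d (Suc (\<nu> k))))\<^sup>2 \<le> (inverse (real (Suc k)))\<^sup>2"
      and \<nu>\<epsilon>: "\<And>k. 2 * inner (v - p) (A (Suc (\<nu> k))) > \<epsilon>" by metis
    have \<nu>N: "\<nu> k \<ge> N" for k using \<nu>[of k] by simp
    have dle: "norm (d (\<nu> k)) \<le> inverse (real (Suc k))" "norm (d (Suc (\<nu> k))) \<le> inverse (real (Suc k))" for k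
    proof -
      have sq: "x \<le> inverse (real (Suc k))" if "x\<^sup>2 \<le> (inverse (real (Suc k)))\<^sup>2" for x :: real
        using that by (rule power2_le_imp_le) simp
      show "norm (d (\<nu> k)) \<le> inverse (real (Suc k))" "norm (d (Suc (\<nu> k))) \<le> inverse (real (Suc k))"
        using \<nu>d[of k] zero_le_power2[of "norm (d (\<nu> k))"] zero_le_power2[of "norm (d (Suc (\<nu> k)))"]
        by (intro sq; linarith)+
    qed
    have dlim: "(\<lambda>k. norm (d (\<nu> k))) \<longlonglongrightarrow> 0" "(\<lambda>k. norm (d (Suc (\<nu> k)))) \<longlonglongrightarrow> 0"
      by (rule tendsto_sandwich[OF _ _ tendsto_const LIMSEQ_inverse_real_of_nat]; use dle in simp)+
    have "filterlim \<nu> at_top sequentially"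
      by (rule filterlim_at_top_mono[OF filterlim_ident always_eventually])
         (use \<nu> in \<open>blast intro: order_trans[OF le_add2]\<close>)
    hence \<sigma>\<nu>: "(\<lambda>k. \<sigma> (\<nu> k)) \<longlonglongrightarrow> 0" using assms(18) filterlim_compose by blast
    have "(\<lambda>k. (1 / \<delta>0) * (\<sigma> (\<nu> k) * (norm (v - p) + B) + 2 * norm (d (\<nu> k))
        + (1 + D * L) * norm (d (Suc (\<nu> k)))))
        \<longlonglongrightarrow> (1 / \<delta>0) * (0 * (norm (v - p) + B) + 2 * 0 + (1 + D * L) * 0)"
      by (intro tendsto_intros dlim \<sigma>\<nu>)
    hence "(\<lambda>k. R (\<nu> k)) \<longlonglongrightarrow> 0"
      using R_le[OF \<nu>N] by (intro Lim_null_comparison[OF always_eventually, of "\<lambda>k. R (\<nu> k)"] allI) simp_all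
    moreover have "norm (w (\<nu> k + 1)) \<le> B + norm p" for k
      using A_le[of "Suc (\<nu> k)"] \<nu>N[of k] norm_triangle_ineq2[of "w (\<nu> k + 1)" p] by (simp add: A_def)
    moreover have "R (\<nu> k) - T (w (\<nu> k + 1)) \<in> S (w (\<nu> k + 1))" for k
      using R_mem N[OF \<nu>N] by blast
    ultimately obtain k where "inner (v - p) (w (\<nu> k + 1) - p) \<le> \<epsilon> / 2"
      using approximate_zeros_proj[OF S T L lip assms(5),
          of "\<lambda>k. w (\<nu> k + 1)" "B + norm p" "\<lambda>k. R (\<nu> k)" "\<epsilon> / 2" v] \<epsilon>
      unfolding p_def by auto
    with \<nu>\<epsilon>[of k] show False by (simp add: A_def)
  qed

  \<comment> \<open>Convergence of the energy and of the iterates\<close>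
  have "E \<longlonglongrightarrow> 0"
  proof (rule averaged_recursion_tendsto_0)
    show "\<forall>\<^sub>F n in sequentially. 0 \<le> E n"
      using eventually_ge_at_top[of N]
    proof eventually_elim
      case (elim n)
      show ?case using E_lower[OF elim] zero_le_power2[of "norm (A n)"] by linarith
    qed
    show "\<sigma> n \<le> 1" if "n \<ge> 1" for n using s01[OF that] by simp
    show "filterlim (\<lambda>N. \<Sum>n=1..N. \<sigma> n) at_top sequentially" by (rule assms(19))
    fix \<epsilon> :: real assume \<epsilon>: "\<epsilon> > 0"
    obtain \<xi> where \<xi>: "\<xi> > 0" and ev_\<xi>: "\<forall>\<^sub>F n in sequentially.
        (norm (d n))\<^sup>2 + (norm (d (Suc n)))\<^sup>2 \<le> \<xi> \<longrightarrow> 2 * inner (v - p) (A (Suc n)) \<le> \<epsilon>"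
      using key[OF \<epsilon>] by blast
    \<comment> \<open>Prepares the case of increments above \<open>\<xi>\<close>: their negative
      contribution is then at least \<open>\<eta> * \<xi> / 2\<close> and outweighs the whole anchor
      term.\<close>
    have "(\<lambda>n. \<sigma> n * (2 * (norm (v - p) * B))) \<longlonglongrightarrow> 0 * (2 * (norm (v - p) * B))"
      by (intro tendsto_intros assms(18))
    hence "\<forall>\<^sub>F n in sequentially. \<sigma> n * (2 * (norm (v - p) * B)) < \<eta> * \<xi> / 2"
      by (rule order_tendstoD(2)) (use \<eta> \<xi> in simp)
    with ev_\<xi> show "\<forall>\<^sub>F n in sequentially. E (Suc n) \<le> (1 - \<sigma> n) * E n + \<sigma> n * \<epsilon>"
      using eventually_ge_at_top[of N]
    proof eventually_elim
      case (elim n)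
      have n: "n \<ge> 1" "\<sigma> n < 1/2" using N[OF elim(3)] by auto
      let ?b = "2 * inner (v - p) (A (Suc n))"
      have "1/2 * \<eta> \<le> (1 - \<sigma> n) * \<eta>"
        using n \<eta> by (intro mult_right_mono) linarith+
      hence half: "\<eta> / 2 * (norm (d n))\<^sup>2 \<le> (1 - \<sigma> n) * \<eta> * (norm (d n))\<^sup>2"
        "\<eta> / 2 * (norm (d (Suc n)))\<^sup>2 \<le> \<eta> * (norm (d (Suc n)))\<^sup>2"
        using \<eta> by (intro mult_right_mono; simp)+
      have step: "E (Suc n) \<le> (1 - \<sigma> n) * E n + \<sigma> n * ?b
          - \<eta> / 2 * ((norm (d n))\<^sup>2 + (norm (d (Suc n)))\<^sup>2)"
      proof -
        have "0 \<le> \<sigma> n * (norm (A (Suc n)))\<^sup>2" using s01[OF n(1)] by simp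
        with E_step[OF elim(3)] half show ?thesis by (simp only: distrib_left)
      qed
      show ?case
      proof (cases "(norm (d n))\<^sup>2 + (norm (d (Suc n)))\<^sup>2 \<le> \<xi>")
        case True
        hence "\<sigma> n * ?b \<le> \<sigma> n * \<epsilon>" using elim(1) s01[OF n(1)] by (intro mult_left_mono) auto
        moreover have "0 \<le> \<eta> / 2 * ((norm (d n))\<^sup>2 + (norm (d (Suc n)))\<^sup>2)" using \<eta> by simp
        ultimately show ?thesis using step by linarith
      next
        case False
        have "inner (v - p) (A (Suc n)) \<le> norm (v - p) * norm (A (Suc n))"
          by (rule norm_cauchy_schwarz)
        also have "\<dots> \<le> norm (v - p) * B" using A_le[of "Suc n"] elim(3) by (intro mult_left_mono) auto
        finally have "\<sigma> n * ?b \<le> \<sigma> n * (2 * (norm (v - p) * B))"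
          using s01[OF n(1)] by (intro mult_left_mono) auto
        moreover have "\<eta> / 2 * \<xi> \<le> \<eta> / 2 * ((norm (d n))\<^sup>2 + (norm (d (Suc n)))\<^sup>2)"
          using False \<eta> by (intro mult_left_mono) auto
        moreover have "0 \<le> \<sigma> n * \<epsilon>" using s01[OF n(1)] \<epsilon> by simp
        ultimately show ?thesis using step elim(2) by linarith
      qed
    qed
  qed
  hence "(\<lambda>n. sqrt (2 * E n)) \<longlonglongrightarrow> sqrt (2 * 0)" by (intro tendsto_intros)
  moreover have "\<forall>\<^sub>F n in sequentially. norm (A n) \<le> sqrt (2 * E n)"
    using eventually_ge_at_top[of N]
  proof eventually_elim
    case (elim n)
    show ?case using E_lower[OF elim] by (intro real_le_rsqrt) simp
  qed
  ultimately have "A \<longlonglongrightarrow> 0" by (intro Lim_null_comparison[of A]) auto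
  thus ?thesis unfolding A_def p_def by (simp add: LIM_zero_iff)
qed

end
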